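(* Let $Q(z)=\sum_{j=1}^dz_jQ_j$ with $Q_j\in M_{s\times r}$ be an $s\times r$ matrix of linear polynomials, and let $\mathbb{D}_Q=\{z\in\mathbb{C}^d:\|Q(z)\|<1\}$ be the corresponding matrix unit ball. Let $f\in\mathcal{SA}(\mathbb{D}_Q)$ be a non-constant function admitting a unitary realization $$f(z)=A+B\bigl[I-(Q(z)\otimes I_{\mathcal{H}})D\bigr]^{-1}(Q(z)\otimes I_{\mathcal{H}})C\qquad\text{for all } z\in\mathbb{D}_Q,$$ where $\mathcal{H}$ is a Hilbert space and $$V=\begin{bmatrix}A&B\\ C&D\end{bmatrix}:\begin{bmatrix}\mathbb{C}\\ \mathbb{C}^s\otimes\mathcal{H}\end{bmatrix}\to\begin{bmatrix}\mathbb{C}\\ \mathbb{C}^r\otimes\mathcal{H}\end{bmatrix}$$ is a unitary operator. Then $$\mathcal{Z}_{\partial\mathbb{D}_Q}(f)\subseteq\sigma_{ap}^Q(D^* ).$$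
   Context: $\|Q(z)\|$ is the operator norm of $Q(z):\mathbb{C}^r\to\mathbb{C}^s$, and $\partial\mathbb{D}_Q=\{z\in\mathbb{C}^d:\|Q(z)\|=1\}$. The (commutative) Schur--Agler class $\mathcal{SA}(\mathbb{D}_Q)$ consists of all holomorphic $f$ on $\mathbb{D}_Q$ such that $\|f(T)\|\le1$ for every tuple $T=(T_1,\dots,T_d)$ of pairwise commuting Hilbert space operators with $\|Q(T)\|<1$; equivalently (Ambrozie--Timotin), those $f$ admitting a unitary realization of the form displayed in the claim. $\mathcal{Z}_{\partial\mathbb{D}_Q}(f)$ is the set of $\lambda\in\partial\mathbb{D}_Q$ such that $\lim_{r\to1^-}f(r\lambda)=0$. For $T\in\mathcal{B}(\mathbb{C}^r\otimes\mathcal{H},\mathbb{C}^s\otimes\mathcal{H})$, $\sigma_{ap}^Q(T)$ is the set of $\lambda\in\mathbb{C}^d$ for which there is a sequence of unit vectors $v_k\in\mathbb{C}^r\otimes\mathcal{H}$ with $\lim_{k\to\infty}\|Tv_k-(Q(\lambda)\otimes I_{\mathcal{H}})v_k\|=0$. *)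

theory Defs
  imports "HOL-Analysis.Analysis"
begin

section \<open>Complex Hilbert spaces\<close>

text \<open>The inner product is linear in its first argument.\<close>

class scaleC =
  fixes scaleC :: "complex \<Rightarrow> 'a \<Rightarrow> 'a"  (infixr "*\<^sub>C" 75)

class complex_inner = real_normed_vector + scaleC +
  fixes cinner :: "'a \<Rightarrow> 'a \<Rightarrow> complex"
  assumes scaleC_add_right: "a *\<^sub>C (x + y) = a *\<^sub>C x + a *\<^sub>C y"
    and scaleC_add_left: "(a + b) *\<^sub>C x = a *\<^sub>C x + b *\<^sub>C x"
    and scaleC_scaleC: "a *\<^sub>C b *\<^sub>C x = (a * b) *\<^sub>C x"
    and scaleC_of_real: "complex_of_real t *\<^sub>C x = t *\<^sub>R x"
    and cinner_commute: "cinner x y = cnj (cinner y x)"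
    and cinner_add_left: "cinner (x + y) z = cinner x z + cinner y z"
    and cinner_scaleC_left: "cinner (a *\<^sub>C x) y = a * cinner x y"
    and cinner_self: "cinner x x = complex_of_real ((norm x)\<^sup>2)"

class chilbert_space = complex_inner + complete_space

instance chilbert_space \<subseteq> banach ..

instantiation complex :: chilbert_space
begin
definition scaleC_complex :: "complex \<Rightarrow> complex \<Rightarrow> complex"
  where "scaleC_complex a x = a * x"
definition cinner_complex :: "complex \<Rightarrow> complex \<Rightarrow> complex"
  where "cinner_complex x y = x * cnj y"
instance
proof
  show "cinner x x = complex_of_real ((norm x)\<^sup>2)" for x :: complex
    unfolding cinner_complex_def by (rule complex_norm_square[symmetric])
qed (simp_all add: scaleC_complex_def cinner_complex_def ring_distribs scaleR_conv_of_real)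
end

instantiation prod :: (complex_inner, complex_inner) complex_inner
begin
definition scaleC_prod :: "complex \<Rightarrow> 'a \<times> 'b \<Rightarrow> 'a \<times> 'b"
  where "scaleC_prod a p = (a *\<^sub>C fst p, a *\<^sub>C snd p)"
definition cinner_prod :: "'a \<times> 'b \<Rightarrow> 'a \<times> 'b \<Rightarrow> complex"
  where "cinner_prod p q = cinner (fst p) (fst q) + cinner (snd p) (snd q)"
instance
proof
  fix p q :: "'a \<times> 'b"
  show "cinner p q = cnj (cinner q p)"
    unfolding cinner_prod_def complex_cnj_add by (intro arg_cong2[where f = "(+)"] cinner_commute)
  show "cinner p p = complex_of_real ((norm p)\<^sup>2)"
    by (simp add: cinner_prod_def cinner_self norm_prod_def)
qed (simp_all add: scaleC_prod_def cinner_prod_def scaleC_add_right scaleC_add_left scaleC_scaleC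
      scaleC_of_real cinner_add_left cinner_scaleC_left ring_distribs scaleR_prod_def)
end

instance prod :: (chilbert_space, chilbert_space) chilbert_space ..

text \<open>For a Hilbert space \<open>'h\<close>, the type \<open>'h ^ 'n\<close> carries the \<open>\<ell>\<^sup>2\<close>-norm and is the Hilbert space
  tensor product of \<open>complex ^ 'n\<close> with \<open>'h\<close>.\<close>

instantiation vec :: (complex_inner, finite) complex_inner
begin
definition scaleC_vec :: "complex \<Rightarrow> 'a ^ 'b \<Rightarrow> 'a ^ 'b"
  where "scaleC_vec a v = (\<chi> i. a *\<^sub>C (v $ i))"
definition cinner_vec :: "'a ^ 'b \<Rightarrow> 'a ^ 'b \<Rightarrow> complex"
  where "cinner_vec v w = (\<Sum>i\<in>UNIV. cinner (v $ i) (w $ i))"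
instance
proof
  fix v w :: "'a ^ 'b"
  show "cinner v w = cnj (cinner w v)"
    unfolding cinner_vec_def cnj_sum by (intro sum.cong refl cinner_commute)
  show "cinner v v = complex_of_real ((norm v)\<^sup>2)"
    by (simp add: cinner_vec_def cinner_self norm_vec_def L2_set_def sum_nonneg)
qed (simp_all add: scaleC_vec_def cinner_vec_def vec_eq_iff scaleC_add_right scaleC_add_left
      scaleC_scaleC scaleC_of_real cinner_add_left cinner_scaleC_left sum.distrib sum_distrib_left)
end

instance vec :: (chilbert_space, finite) chilbert_space ..

section \<open>The Hilbert space of square-summable sequences\<close>

typedef ell2 = "{x :: nat \<Rightarrow> complex. summable (\<lambda>n. (cmod (x n))\<^sup>2)}"
  morphisms ell2_nth Abs_ell2
  by (rule exI[of _ "\<lambda>_. 0"]) simp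

lemma summable_ell2 [simp]: "summable (\<lambda>n. (cmod (ell2_nth x n))\<^sup>2)"
  using ell2_nth[of x] by simp

lemma ell2_eq_iff: "x = y \<longleftrightarrow> (\<forall>n. ell2_nth x n = ell2_nth y n)"
  by (metis ell2_nth_inject ext)

lemma square_summable_add:
  fixes x y :: "nat \<Rightarrow> complex"
  assumes "summable (\<lambda>n. (cmod (x n))\<^sup>2)" "summable (\<lambda>n. (cmod (y n))\<^sup>2)"
  shows "summable (\<lambda>n. (cmod (x n + y n))\<^sup>2)"
proof (rule summable_comparison_test')
  show "summable (\<lambda>n. 2 * (cmod (x n))\<^sup>2 + 2 * (cmod (y n))\<^sup>2)"
    by (intro summable_add summable_mult assms)
  show "norm ((cmod (x n + y n))\<^sup>2) \<le> 2 * (cmod (x n))\<^sup>2 + 2 * (cmod (y n))\<^sup>2" if "0 \<le> n" for n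
  proof -
    have "(cmod (x n + y n))\<^sup>2 \<le> (cmod (x n) + cmod (y n))\<^sup>2"
      by (intro power_mono norm_triangle_ineq) auto
    also have "\<dots> \<le> 2 * (cmod (x n))\<^sup>2 + 2 * (cmod (y n))\<^sup>2"
      using sum_squares_bound[of "cmod (x n)" "cmod (y n)"] by (simp add: power2_sum)
    finally show ?thesis by simp
  qed
qed

lemma square_summable_mult:
  fixes x :: "nat \<Rightarrow> complex"
  shows "summable (\<lambda>n. (cmod (x n))\<^sup>2) \<Longrightarrow> summable (\<lambda>n. (cmod (a * x n))\<^sup>2)"
  by (simp add: norm_mult power_mult_distrib summable_mult)

lemma ell2_inner_summable: "summable (\<lambda>n. ell2_nth x n * cnj (ell2_nth y n))"
proof (rule summable_comparison_test')
  show "summable (\<lambda>n. (cmod (ell2_nth x n))\<^sup>2 + (cmod (ell2_nth y n))\<^sup>2)"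
    by (intro summable_add summable_ell2)
  show "norm (ell2_nth x n * cnj (ell2_nth y n)) \<le> (cmod (ell2_nth x n))\<^sup>2 + (cmod (ell2_nth y n))\<^sup>2"
    if "0 \<le> n" for n
    using sum_squares_bound[of "cmod (ell2_nth x n)" "cmod (ell2_nth y n)"]
      mult_nonneg_nonneg[OF norm_ge_zero[of "ell2_nth x n"] norm_ge_zero[of "ell2_nth y n"]]
    unfolding norm_mult mult.assoc complex_mod_cnj by linarith
qed

instantiation ell2 :: complex_inner
begin

definition zero_ell2 :: ell2 where "0 = Abs_ell2 (\<lambda>_. 0)"
definition plus_ell2 :: "ell2 \<Rightarrow> ell2 \<Rightarrow> ell2"
  where "x + y = Abs_ell2 (\<lambda>n. ell2_nth x n + ell2_nth y n)"
definition scaleC_ell2 :: "complex \<Rightarrow> ell2 \<Rightarrow> ell2"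
  where "a *\<^sub>C x = Abs_ell2 (\<lambda>n. a * ell2_nth x n)"
definition scaleR_ell2 :: "real \<Rightarrow> ell2 \<Rightarrow> ell2"
  where "t *\<^sub>R x = complex_of_real t *\<^sub>C (x :: ell2)"
definition uminus_ell2 :: "ell2 \<Rightarrow> ell2" where "- x = (- 1) *\<^sub>C (x :: ell2)"
definition minus_ell2 :: "ell2 \<Rightarrow> ell2 \<Rightarrow> ell2" where "x - y = x + - (y :: ell2)"
definition norm_ell2 :: "ell2 \<Rightarrow> real"
  where "norm x = sqrt (\<Sum>n. (cmod (ell2_nth x n))\<^sup>2)"
definition sgn_ell2 :: "ell2 \<Rightarrow> ell2" where "sgn x = inverse (norm x) *\<^sub>R (x :: ell2)"
definition dist_ell2 :: "ell2 \<Rightarrow> ell2 \<Rightarrow> real" where "dist x y = norm (x - y :: ell2)"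
definition uniformity_ell2 :: "(ell2 \<times> ell2) filter"
  where "uniformity_ell2 = (INF e\<in>{0 <..}. principal {(x, y). dist x y < e})"
definition open_ell2 :: "ell2 set \<Rightarrow> bool"
  where "open_ell2 U \<longleftrightarrow> (\<forall>x\<in>U. eventually (\<lambda>(x', y). x' = x \<longrightarrow> y \<in> U) uniformity)"
definition cinner_ell2 :: "ell2 \<Rightarrow> ell2 \<Rightarrow> complex"
  where "cinner x y = (\<Sum>n. ell2_nth x n * cnj (ell2_nth y n))"

lemma ell2_nth_zero: "ell2_nth 0 n = 0"
  by (simp add: zero_ell2_def Abs_ell2_inverse)

lemma ell2_nth_add: "ell2_nth (x + y) n = ell2_nth x n + ell2_nth y n"
  by (simp add: plus_ell2_def Abs_ell2_inverse square_summable_add)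

lemma ell2_nth_scaleC: "ell2_nth (a *\<^sub>C x) n = a * ell2_nth x n"
  by (simp add: scaleC_ell2_def Abs_ell2_inverse square_summable_mult)

lemma ell2_nth_scaleR: "ell2_nth (t *\<^sub>R x) n = complex_of_real t * ell2_nth x n"
  by (simp add: scaleR_ell2_def ell2_nth_scaleC)

lemma ell2_nth_minus: "ell2_nth (- x) n = - ell2_nth x n"
  by (simp add: uminus_ell2_def ell2_nth_scaleC)

lemma ell2_nth_diff: "ell2_nth (x - y) n = ell2_nth x n - ell2_nth y n"
  by (simp add: minus_ell2_def ell2_nth_add ell2_nth_minus)

lemmas ell2_nth_simps =
  ell2_nth_zero ell2_nth_add ell2_nth_scaleC ell2_nth_scaleR ell2_nth_minus ell2_nth_diff

lemma L2_set_le_norm_ell2: "L2_set (\<lambda>n. cmod (ell2_nth x n)) {..<N} \<le> norm x"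
  unfolding L2_set_def norm_ell2_def by (intro real_sqrt_le_mono sum_le_suminf) auto

lemma norm_ell2_le:
  assumes "\<And>N. L2_set (\<lambda>n. cmod (ell2_nth x n)) {..<N} \<le> b"
  shows "norm x \<le> b"
proof -
  have "0 \<le> b" using assms[of 0] by simp
  have "(\<Sum>n<N. (cmod (ell2_nth x n))\<^sup>2) \<le> b\<^sup>2" for N
    using assms[of N] unfolding L2_set_def by (simp add: sqrt_le_D)
  then have "(\<Sum>n. (cmod (ell2_nth x n))\<^sup>2) \<le> b\<^sup>2"
    by (intro suminf_le_const) auto
  then show ?thesis
    unfolding norm_ell2_def using \<open>0 \<le> b\<close> by (simp add: real_le_lsqrt suminf_nonneg)
qed

instance
proof
  fix x y z :: ell2 and a b :: complex and s t :: real
  show "dist x y = norm (x - y)" by (rule dist_ell2_def)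
  show "sgn x = inverse (norm x) *\<^sub>R x" by (rule sgn_ell2_def)
  show "uniformity = (INF e\<in>{0 <..}. principal {(x :: ell2, y). dist x y < e})"
    by (rule uniformity_ell2_def)
  show "open U \<longleftrightarrow> (\<forall>x\<in>U. eventually (\<lambda>(x', y). x' = x \<longrightarrow> y \<in> U) uniformity)" for U :: "ell2 set"
    by (rule open_ell2_def)
  show "norm x = 0 \<longleftrightarrow> x = 0"
    unfolding norm_ell2_def real_sqrt_eq_0_iff
    by (subst suminf_eq_zero_iff) (simp_all add: ell2_eq_iff ell2_nth_zero)
  show "norm (x + y) \<le> norm x + norm y"
  proof (rule norm_ell2_le)
    fix N
    have "L2_set (\<lambda>n. cmod (ell2_nth (x + y) n)) {..<N}
        \<le> L2_set (\<lambda>n. cmod (ell2_nth x n) + cmod (ell2_nth y n)) {..<N}"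
      by (intro L2_set_mono) (auto simp: ell2_nth_add norm_triangle_ineq)
    also have "\<dots> \<le> L2_set (\<lambda>n. cmod (ell2_nth x n)) {..<N} + L2_set (\<lambda>n. cmod (ell2_nth y n)) {..<N}"
      by (rule L2_set_triangle_ineq)
    also have "\<dots> \<le> norm x + norm y"
      by (intro add_mono L2_set_le_norm_ell2)
    finally show "L2_set (\<lambda>n. cmod (ell2_nth (x + y) n)) {..<N} \<le> norm x + norm y" .
  qed
  show "norm (t *\<^sub>R x) = \<bar>t\<bar> * norm x"
    unfolding norm_ell2_def ell2_nth_scaleR norm_mult power_mult_distrib norm_of_real
    by (subst suminf_mult) (simp_all add: real_sqrt_mult)
  show "complex_of_real t *\<^sub>C x = t *\<^sub>R x" by (simp add: scaleR_ell2_def)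
  show "cinner x y = cnj (cinner y x)"
    unfolding cinner_ell2_def
    by (subst bounded_linear.suminf[OF bounded_linear_cnj ell2_inner_summable]) (simp add: mult.commute)
  show "cinner (x + y) z = cinner x z + cinner y z"
    unfolding cinner_ell2_def
    by (subst suminf_add[OF ell2_inner_summable ell2_inner_summable])
      (simp add: ell2_nth_add algebra_simps)
  show "cinner (a *\<^sub>C x) y = a * cinner x y"
    unfolding cinner_ell2_def
    by (subst suminf_mult[OF ell2_inner_summable, symmetric]) (simp add: ell2_nth_scaleC mult.assoc)
  have "cinner x x = (\<Sum>n. complex_of_real ((cmod (ell2_nth x n))\<^sup>2))"
    unfolding cinner_ell2_def by (simp only: complex_norm_square)
  also have "\<dots> = complex_of_real (\<Sum>n. (cmod (ell2_nth x n))\<^sup>2)"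
    by (rule bounded_linear.suminf[OF bounded_linear_of_real summable_ell2, symmetric])
  also have "\<dots> = complex_of_real ((norm x)\<^sup>2)"
    by (simp add: norm_ell2_def suminf_nonneg)
  finally show "cinner x x = complex_of_real ((norm x)\<^sup>2)" .
qed (simp_all add: ell2_eq_iff ell2_nth_simps ring_distribs)

end

instance ell2 :: chilbert_space
proof
  fix X :: "nat \<Rightarrow> ell2"
  assume X: "Cauchy X"
  have coord: "cmod (ell2_nth x n) \<le> norm x" for x n
  proof -
    have "cmod (ell2_nth x n) \<le> L2_set (\<lambda>n. cmod (ell2_nth x n)) {..<Suc n}"
      by (rule member_le_L2_set) auto
    then show ?thesis using L2_set_le_norm_ell2 order_trans by blast
  qed
  have "convergent (\<lambda>k. ell2_nth (X k) n)" for n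
    unfolding Cauchy_convergent_iff[symmetric]
  proof (rule metric_CauchyI)
    fix e :: real assume "0 < e"
    then obtain M where "\<forall>k\<ge>M. \<forall>m\<ge>M. dist (X k) (X m) < e"
      using metric_CauchyD[OF X] by blast
    moreover have "dist (ell2_nth (X k) n) (ell2_nth (X m) n) \<le> dist (X k) (X m)" for k m
      using coord[of "X k - X m" n] by (simp add: dist_norm ell2_nth_diff)
    ultimately show "\<exists>M. \<forall>k\<ge>M. \<forall>m\<ge>M. dist (ell2_nth (X k) n) (ell2_nth (X m) n) < e"
      by (meson order_le_less_trans)
  qed
  then obtain l where l: "\<And>n. (\<lambda>k. ell2_nth (X k) n) \<longlonglongrightarrow> l n"
    unfolding convergent_def by metis
  have bound: "\<exists>M. \<forall>k\<ge>M. \<forall>N. L2_set (\<lambda>n. cmod (ell2_nth (X k) n - l n)) {..<N} \<le> e"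
    if "0 < e" for e :: real
  proof -
    obtain M where M: "\<And>k m. k \<ge> M \<Longrightarrow> m \<ge> M \<Longrightarrow> dist (X k) (X m) < e"
      using metric_CauchyD[OF X \<open>0 < e\<close>] by blast
    have "L2_set (\<lambda>n. cmod (ell2_nth (X k) n - l n)) {..<N} \<le> e" if "k \<ge> M" for k N
    proof (rule LIMSEQ_le_const2)
      show "(\<lambda>m. L2_set (\<lambda>n. cmod (ell2_nth (X k) n - ell2_nth (X m) n)) {..<N})
          \<longlonglongrightarrow> L2_set (\<lambda>n. cmod (ell2_nth (X k) n - l n)) {..<N}"
        unfolding L2_set_def by (intro tendsto_intros l)
      have "L2_set (\<lambda>n. cmod (ell2_nth (X k) n - ell2_nth (X m) n)) {..<N} \<le> e" if "m \<ge> M" for m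
        using L2_set_le_norm_ell2[of "X k - X m" N] M[OF \<open>k \<ge> M\<close> that]
        by (simp add: dist_norm ell2_nth_diff)
      then show "\<exists>M. \<forall>m\<ge>M. L2_set (\<lambda>n. cmod (ell2_nth (X k) n - ell2_nth (X m) n)) {..<N} \<le> e"
        by blast
    qed
    then show ?thesis by blast
  qed
  have l_summable: "summable (\<lambda>n. (cmod (l n))\<^sup>2)"
  proof -
    obtain M where M: "\<And>N. L2_set (\<lambda>n. cmod (ell2_nth (X M) n - l n)) {..<N} \<le> 1"
      using bound[of 1] by auto
    have "summable (\<lambda>n. (cmod (ell2_nth (X M) n - l n))\<^sup>2)"
    proof (rule summableI_nonneg_bounded)
      show "(\<Sum>n<N. (cmod (ell2_nth (X M) n - l n))\<^sup>2) \<le> 1" for N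
        using M[of N] by (simp add: L2_set_def)
    qed simp
    from square_summable_add[OF square_summable_mult[OF this, of "- 1"] summable_ell2[of "X M"]]
    show ?thesis by simp
  qed
  define L where "L = Abs_ell2 l"
  have L: "ell2_nth L n = l n" for n
    using l_summable by (simp add: L_def Abs_ell2_inverse)
  have "X \<longlonglongrightarrow> L"
  proof (rule metric_LIMSEQ_I)
    fix e :: real assume "0 < e"
    then obtain M where "\<And>k N. k \<ge> M \<Longrightarrow> L2_set (\<lambda>n. cmod (ell2_nth (X k) n - l n)) {..<N} \<le> e / 2"
      using bound[of "e / 2"] by auto
    then have half: "norm (X k - L) \<le> e / 2" if "k \<ge> M" for k
      using that by (intro norm_ell2_le) (simp add: ell2_nth_diff L)
    have "dist (X k) L < e" if "k \<ge> M" for k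
      using half[OF that] \<open>0 < e\<close> by (simp add: dist_norm)
    then show "\<exists>M. \<forall>k\<ge>M. dist (X k) L < e" by blast
  qed
  then show "convergent X" unfolding convergent_def by blast
qed

section \<open>Operators\<close>

definition bounded_clinear :: "('a::complex_inner \<Rightarrow> 'b::complex_inner) \<Rightarrow> bool"
  where "bounded_clinear F \<longleftrightarrow> bounded_linear F \<and> (\<forall>a x. F (a *\<^sub>C x) = a *\<^sub>C F x)"

definition unitary_op :: "('a::complex_inner \<Rightarrow> 'b::complex_inner) \<Rightarrow> bool"
  where "unitary_op V \<longleftrightarrow>
    bounded_clinear V \<and> surj V \<and> (\<forall>x y. cinner (V x) (V y) = cinner x y)"

definition cadjoint :: "('a::complex_inner \<Rightarrow> 'b::complex_inner) \<Rightarrow> 'b \<Rightarrow> 'a"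
  where "cadjoint F = (SOME G. \<forall>x y. cinner (F x) y = cinner x (G y))"

definition block_op ::
    "('a \<Rightarrow> 'c) \<Rightarrow> ('b \<Rightarrow> 'c) \<Rightarrow> ('a \<Rightarrow> 'e) \<Rightarrow> ('b \<Rightarrow> 'e) \<Rightarrow> 'a \<times> 'b \<Rightarrow> 'c::plus \<times> 'e::plus"
  where "block_op A B C D = (\<lambda>(a, x). (A a + B x, C a + D x))"

text \<open>The operator \<open>M \<otimes> I\<close>, from \<open>'h ^ 'r\<close> to \<open>'h ^ 's\<close>.\<close>

definition ampl :: "complex ^ 'r ^ 's \<Rightarrow> 'h::complex_inner ^ 'r \<Rightarrow> 'h ^ 's"
  where "ampl M v = (\<chi> i. \<Sum>k\<in>UNIV. M $ i $ k *\<^sub>C v $ k)"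

section \<open>Linear matrix polynomials and the matrix unit ball\<close>

text \<open>A family \<open>Q :: 'd \<Rightarrow> complex ^ 'r ^ 's\<close> lists the coefficient matrices \<open>Q\<^sub>j\<close>.\<close>

definition pencil :: "('d::finite \<Rightarrow> complex ^ 'r ^ 's) \<Rightarrow> complex ^ 'd \<Rightarrow> complex ^ 'r ^ 's"
  where "pencil Q z = (\<Sum>j\<in>UNIV. z $ j *\<^sub>C Q j)"

definition matrix_ball :: "('d::finite \<Rightarrow> complex ^ 'r::finite ^ 's::finite) \<Rightarrow> (complex ^ 'd) set"
  where "matrix_ball Q = {z. onorm (\<lambda>v. pencil Q z *v v) < 1}"

definition matrix_ball_bdry :: "('d::finite \<Rightarrow> complex ^ 'r::finite ^ 's::finite) \<Rightarrow> (complex ^ 'd) set"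
  where "matrix_ball_bdry Q = {z. onorm (\<lambda>v. pencil Q z *v v) = 1}"

text \<open>The operator \<open>Q(T) = \<Sum>\<^sub>j Q\<^sub>j \<otimes> T\<^sub>j\<close>.\<close>

definition pencil_op ::
    "('d::finite \<Rightarrow> complex ^ 'r ^ 's) \<Rightarrow> ('d \<Rightarrow> 'k \<Rightarrow> 'k) \<Rightarrow> 'k::complex_inner ^ 'r \<Rightarrow> 'k ^ 's"
  where "pencil_op Q T v = (\<Sum>j\<in>UNIV. ampl (Q j) (\<chi> k. T j (v $ k)))"

section \<open>The Schur--Agler class\<close>

definition cholomorphic_on :: "('a::complex_inner \<Rightarrow> complex) \<Rightarrow> 'a set \<Rightarrow> bool"
  where "cholomorphic_on f U \<longleftrightarrow> (\<forall>z\<in>U. \<exists>L. bounded_clinear L \<and> (f has_derivative L) (at z))"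

text \<open>Since \<open>matrix_ball Q\<close> is an open balanced set, a holomorphic \<open>f\<close> on it has an
  expansion into homogeneous polynomials, converging on the whole ball, with unique coefficients \<open>c\<close>
  (those of the Taylor series at the origin). The monomials have to be grouped by degree: the
  ungrouped power series need not converge on the ball.\<close>

definition multi_indices :: "nat \<Rightarrow> ('d::finite \<Rightarrow> nat) set"
  where "multi_indices n = {\<alpha>. (\<Sum>j\<in>UNIV. \<alpha> j) = n}"

definition homogeneous_expansion ::
    "(('d::finite \<Rightarrow> nat) \<Rightarrow> complex) \<Rightarrow> (complex ^ 'd \<Rightarrow> complex) \<Rightarrow> (complex ^ 'd) set \<Rightarrow> bool"
  where "homogeneous_expansion c f U \<longleftrightarrow>
    (\<forall>z\<in>U. (\<lambda>n. \<Sum>\<alpha>\<in>multi_indices n. c \<alpha> * (\<Prod>j\<in>UNIV. (z $ j) ^ \<alpha> j)) sums f z)"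

text \<open>\<open>T\<^sup>\<alpha>\<close>; the order of the factors is irrelevant because this is only used for commuting tuples.\<close>

definition monomial_op :: "('d::finite \<Rightarrow> 'k \<Rightarrow> 'k) \<Rightarrow> ('d \<Rightarrow> nat) \<Rightarrow> 'k \<Rightarrow> 'k"
  where "monomial_op T \<alpha> = Finite_Set.fold (\<lambda>j S. (T j ^^ \<alpha> j) \<circ> S) id UNIV"

text \<open>\<open>F = f(T)\<close>: the homogeneous expansion of \<open>f\<close>, evaluated at \<open>T\<close>, converges to \<open>F\<close> in operator
  norm. When \<open>\<parallel>Q(T)\<parallel> < 1\<close>, this agrees with the holomorphic functional calculus, which is continuous
  and in which the homogeneous expansion of \<open>f\<close> converges locally uniformly on the ball.\<close>

definition has_fun_calc ::
    "('d::finite \<Rightarrow> complex ^ 'r::finite ^ 's::finite) \<Rightarrow> (complex ^ 'd \<Rightarrow> complex) \<Rightarrow>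
      ('d \<Rightarrow> 'k \<Rightarrow> 'k) \<Rightarrow> ('k::complex_inner \<Rightarrow> 'k) \<Rightarrow> bool"
  where "has_fun_calc Q f T F \<longleftrightarrow>
    (\<exists>c. homogeneous_expansion c f (matrix_ball Q) \<and>
      (\<lambda>N. onorm (\<lambda>x. (\<Sum>n<N. \<Sum>\<alpha>\<in>multi_indices n. c \<alpha> *\<^sub>C monomial_op T \<alpha> x) - F x)) \<longlonglongrightarrow> 0)"

text \<open>All Hilbert space operators are modelled by operators on \<open>\<ell>\<^sup>2\<close>. Nothing is lost: \<open>\<parallel>f(T)\<parallel>\<close> is
  the supremum of \<open>\<parallel>f(T|K)\<parallel>\<close> over the separable \<open>T\<close>-invariant closed subspaces \<open>K\<close>, where
  \<open>\<parallel>Q(T|K)\<parallel> \<le> \<parallel>Q(T)\<parallel>\<close>, and an operator tuple on a separable space extends by zero to \<open>\<ell>\<^sup>2\<close>.\<close>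

definition schur_agler ::
    "('d::finite \<Rightarrow> complex ^ 'r::finite ^ 's::finite) \<Rightarrow> (complex ^ 'd \<Rightarrow> complex) set"
  where "schur_agler Q = {f. cholomorphic_on f (matrix_ball Q) \<and>
    (\<forall>T :: 'd \<Rightarrow> ell2 \<Rightarrow> ell2.
      (\<forall>j. bounded_clinear (T j)) \<and> (\<forall>i j. T i \<circ> T j = T j \<circ> T i) \<and> onorm (pencil_op Q T) < 1 \<longrightarrow>
      (\<exists>F. bounded_clinear F \<and> has_fun_calc Q f T F \<and> onorm F \<le> 1))}"

section \<open>Realizations, boundary zeros and the approximate spectrum\<close>

text \<open>\<open>A + B [I - (Q(z) \<otimes> I) D]\<^sup>-\<^sup>1 (Q(z) \<otimes> I) C\<close> is an operator on the scalars, identified with its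
  value at \<open>1\<close>.\<close>

definition transfer_function ::
    "('d::finite \<Rightarrow> complex ^ 'r ^ 's) \<Rightarrow> (complex \<Rightarrow> complex) \<Rightarrow> ('h::complex_inner ^ 's \<Rightarrow> complex) \<Rightarrow>
      (complex \<Rightarrow> 'h ^ 'r) \<Rightarrow> ('h ^ 's \<Rightarrow> 'h ^ 'r) \<Rightarrow> complex ^ 'd \<Rightarrow> complex"
  where "transfer_function Q A B C D z =
    A 1 + B (inv (\<lambda>y. y - ampl (pencil Q z) (D y)) (ampl (pencil Q z) (C 1)))"

definition unitary_realization ::
    "('d::finite \<Rightarrow> complex ^ 'r::finite ^ 's::finite) \<Rightarrow> (complex ^ 'd \<Rightarrow> complex) \<Rightarrow>
      (complex \<Rightarrow> complex) \<Rightarrow> ('h::chilbert_space ^ 's \<Rightarrow> complex) \<Rightarrow>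
      (complex \<Rightarrow> 'h ^ 'r) \<Rightarrow> ('h ^ 's \<Rightarrow> 'h ^ 'r) \<Rightarrow> bool"
  where "unitary_realization Q f A B C D \<longleftrightarrow>
    bounded_clinear A \<and> bounded_clinear B \<and> bounded_clinear C \<and> bounded_clinear D \<and>
    unitary_op (block_op A B C D) \<and>
    (\<forall>z\<in>matrix_ball Q. f z = transfer_function Q A B C D z)"

definition boundary_zeros ::
    "('d::finite \<Rightarrow> complex ^ 'r::finite ^ 's::finite) \<Rightarrow> (complex ^ 'd \<Rightarrow> complex) \<Rightarrow> (complex ^ 'd) set"
  where "boundary_zeros Q f =
    {l \<in> matrix_ball_bdry Q. ((\<lambda>t. f (t *\<^sub>R l)) \<longlongrightarrow> 0) (at_left 1)}"

definition approx_spectrum ::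
    "('d::finite \<Rightarrow> complex ^ 'r::finite ^ 's::finite) \<Rightarrow> ('h::chilbert_space ^ 'r \<Rightarrow> 'h ^ 's) \<Rightarrow>
      (complex ^ 'd) set"
  where "approx_spectrum Q T =
    {l. \<exists>v :: nat \<Rightarrow> 'h ^ 'r. (\<forall>k. norm (v k) = 1) \<and>
      (\<lambda>k. norm (T (v k) - ampl (pencil Q l) (v k))) \<longlonglongrightarrow> 0}"

end

theory Submission
  imports Defs
begin

text \<open>
  Write \<open>V\<close> for the unitary block operator and let \<open>\<lambda>\<close> be a boundary point at which \<open>f\<close> vanishes
  radially. For \<open>0 \<le> t < 1\<close> the operator \<open>t Q(\<lambda>) \<otimes> I\<close> is a strict contraction and \<open>D\<close>, being a corner
  of \<open>V\<close>, is a contraction. So the feedback equation \<open>y = (t Q(\<lambda>) \<otimes> I) (C 1 + D y)\<close> has a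
  solution, and with \<open>w = C 1 + D y\<close> the realization says exactly
  \<open>V (1, y) = (f (t \<lambda>), w)\<close> and \<open>y = (t Q(\<lambda>) \<otimes> I) w\<close>.

  Two consequences of unitarity are played against each other. Inverting \<open>V\<close> and reading off the
  second component shows that \<open>D\<^sup>* w\<close> differs from \<open>y\<close> by a vector of norm at most \<open>\<bar>f (t \<lambda>)\<bar>\<close>, hence
  \<open>\<parallel>D\<^sup>* w - (Q(\<lambda>) \<otimes> I) w\<parallel> \<le> \<bar>f (t \<lambda>)\<bar> + (1 - t) \<parallel>w\<parallel>\<close>. Comparing norms gives
  \<open>\<parallel>w\<parallel>\<^sup>2 \<ge> 1 - \<bar>f (t \<lambda>)\<bar>\<^sup>2\<close>, so \<open>w\<close> stays away from zero as \<open>f (t \<lambda>) \<rightarrow> 0\<close>. The normalized vectors \<open>w\<close>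
  are therefore approximate eigenvectors.

  It remains to see why \<open>t Q(\<lambda>) \<otimes> I\<close> is a strict contraction: passing from a matrix \<open>M\<close> to
  \<open>M \<otimes> I\<close> does not increase the operator norm (\<open>norm_ampl_le\<close>). The vector \<open>w\<close> comes from
  \<open>transfer_function_feedback\<close>, and the bound on \<open>D\<^sup>* w - y\<close> is \<open>cadjoint_corner_estimate\<close>.
\<close>

section \<open>Complex inner products\<close>

lemma scaleC_zero_right [simp]: "a *\<^sub>C (0 :: 'a::complex_inner) = 0"
  using scaleC_add_right[of a "0 :: 'a" 0] by simp

lemma scaleC_zero_left [simp]: "0 *\<^sub>C (x :: 'a::complex_inner) = 0"
  using scaleC_of_real[of 0 x] by simp

lemma scaleC_minus_right: "a *\<^sub>C (- x) = - (a *\<^sub>C (x :: 'a::complex_inner))"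
  using scaleC_add_right[of a x "- x"] by (simp add: eq_neg_iff_add_eq_0 add.commute)

lemma scaleC_diff_right: "a *\<^sub>C (x - y) = a *\<^sub>C x - a *\<^sub>C (y :: 'a::complex_inner)"
  using scaleC_add_right[of a x "- y"] by (simp add: scaleC_minus_right)

lemma scaleC_sum_left: "(\<Sum>k\<in>S. a k) *\<^sub>C (x :: 'a::complex_inner) = (\<Sum>k\<in>S. a k *\<^sub>C x)"
  by (induction S rule: infinite_finite_induct) (simp_all add: scaleC_add_left)

lemma cinner_add_right: "cinner x (y + z) = cinner x y + cinner x (z :: 'a::complex_inner)"
  by (metis cinner_add_left cinner_commute complex_cnj_add)

lemma cinner_scaleC_right: "cinner x (a *\<^sub>C y) = cnj a * cinner x (y :: 'a::complex_inner)"
  by (metis cinner_scaleC_left cinner_commute complex_cnj_mult)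

lemma cinner_zero_left [simp]: "cinner 0 (x :: 'a::complex_inner) = 0"
  using cinner_add_left[of "0 :: 'a" 0 x] by simp

lemma cinner_zero_right [simp]: "cinner (x :: 'a::complex_inner) 0 = 0"
  using cinner_add_right[of x "0 :: 'a" 0] by simp

lemma cinner_diff_right: "cinner x (y - z) = cinner x y - cinner x (z :: 'a::complex_inner)"
  using cinner_add_right[of x "y - z" z] by simp

lemma cinner_ext:
  fixes u v :: "'a::complex_inner"
  assumes "\<And>x. cinner x u = cinner x v"
  shows "u = v"
proof -
  have "cinner (u - v) (u - v) = 0"
    using assms by (simp add: cinner_diff_right)
  then show ?thesis by (simp add: cinner_self)
qed

lemma norm_scaleC: "norm (a *\<^sub>C (x :: 'a::complex_inner)) = cmod a * norm x"
proof -
  have "complex_of_real ((norm (a *\<^sub>C x))\<^sup>2) = (a * cnj a) * cinner x x"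
    by (simp only: cinner_self[symmetric] cinner_scaleC_left cinner_scaleC_right ac_simps)
  also have "\<dots> = complex_of_real ((cmod a * norm x)\<^sup>2)"
    by (simp only: complex_norm_square[symmetric] cinner_self power_mult_distrib of_real_mult)
  finally have "(norm (a *\<^sub>C x))\<^sup>2 = (cmod a * norm x)\<^sup>2"
    by (simp only: of_real_eq_iff)
  then show ?thesis by (simp add: power2_eq_iff_nonneg)
qed

lemma norm_add_square_orthogonal:
  fixes x y :: "'a::complex_inner"
  assumes "cinner x y = 0"
  shows "(norm (x + y))\<^sup>2 = (norm x)\<^sup>2 + (norm y)\<^sup>2"
proof -
  have "cinner y x = 0"
    using assms cinner_commute[of y x] by simp
  then have "complex_of_real ((norm (x + y))\<^sup>2) = complex_of_real ((norm x)\<^sup>2 + (norm y)\<^sup>2)"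
    using assms
    by (simp only: cinner_self[symmetric] cinner_add_left cinner_add_right of_real_add) simp
  then show ?thesis by (simp only: of_real_eq_iff)
qed

lemma norm_eq_if_cinner_preserved:
  fixes V :: "'a::complex_inner \<Rightarrow> 'b::complex_inner"
  assumes "cinner (V x) (V x) = cinner x x"
  shows "norm (V x) = norm x"
proof -
  have "(norm (V x))\<^sup>2 = (norm x)\<^sup>2"
    using assms by (simp only: cinner_self of_real_eq_iff)
  then show ?thesis by (simp add: power2_eq_iff_nonneg)
qed

section \<open>Amplifications of matrices\<close>

lemma ampl_add: "ampl M (v + w) = ampl M v + ampl M w"
  by (simp add: ampl_def vec_eq_iff scaleC_add_right sum.distrib)

lemma ampl_diff: "ampl M (v - w) = ampl M v - ampl M w"
  by (simp add: ampl_def vec_eq_iff scaleC_diff_right sum_subtractf)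

lemma scaleR_scaleC_left: "(t *\<^sub>R a) *\<^sub>C x = t *\<^sub>R (a *\<^sub>C (x :: 'a::complex_inner))"
  by (metis scaleC_of_real scaleC_scaleC scaleR_conv_of_real)

lemma scaleC_scaleR_commute: "a *\<^sub>C (t *\<^sub>R x) = t *\<^sub>R (a *\<^sub>C (x :: 'a::complex_inner))"
  by (metis mult.commute scaleC_of_real scaleC_scaleC)

lemma ampl_scaleR: "ampl (t *\<^sub>R M) v = t *\<^sub>R ampl M v"
  by (simp add: ampl_def vec_eq_iff scaleR_sum_right scaleR_scaleC_left)

lemma ampl_scaleR_right: "ampl M (t *\<^sub>R v) = t *\<^sub>R ampl M v"
  by (simp add: ampl_def vec_eq_iff scaleR_sum_right scaleC_scaleR_commute)

lemma pencil_scaleR: "pencil Q (t *\<^sub>R z) = t *\<^sub>R pencil Q z"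
  by (simp add: pencil_def scaleR_sum_right scaleR_scaleC_left)

lemma bounded_linear_matrix: "bounded_linear (\<lambda>v. (M :: complex ^ 'r::finite ^ 's::finite) *v v)"
proof -
  have "linear (\<lambda>v. M *v v)"
    by (rule linearI)
      (simp_all add: matrix_vector_mult_def vec_eq_iff ring_distribs sum.distrib scaleR_sum_right)
  then show ?thesis by (simp add: linear_conv_bounded_linear)
qed

lemma ampl_tensor:
  "ampl M (\<chi> k. (x $ k) *\<^sub>C e) = (\<chi> i. ((M *v x) $ i) *\<^sub>C (e :: 'h::complex_inner))"
  by (simp add: ampl_def matrix_vector_mult_def vec_eq_iff scaleC_scaleC scaleC_sum_left)

lemma norm_tensor_unit:
  assumes "norm e = 1"
  shows "norm (\<chi> k. (x $ k) *\<^sub>C (e :: 'h::complex_inner)) = norm (x :: complex ^ 'n)"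
  using assms by (simp add: norm_vec_def norm_scaleC)

lemma cinner_ampl_eq_0:
  fixes v :: "'h::complex_inner ^ 'r::finite"
  assumes "\<And>k. cinner e (v $ k) = 0"
  shows "cinner (\<chi> i. (a $ i) *\<^sub>C e) (ampl M v) = 0"
proof -
  have "cinner e (\<Sum>k\<in>S. c k *\<^sub>C v $ k) = 0" if "finite S" for S c
    using that
    by (induction S rule: finite_induct) (simp_all add: assms cinner_add_right cinner_scaleC_right)
  then show ?thesis
    by (simp add: cinner_vec_def ampl_def cinner_scaleC_left)
qed

lemma cinner_tensor_eq_0:
  assumes "\<And>k. cinner e (v $ k) = 0"
  shows "cinner (\<chi> i. (a $ i) *\<^sub>C e) v = 0"
  by (simp add: cinner_vec_def cinner_scaleC_left assms)

text \<open>
  If some entry \<open>v\<^sub>k\<close> is nonzero, split every entry into its component along \<open>e = v\<^sub>k / \<parallel>v\<^sub>k\<parallel>\<close> and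
  its component orthogonal to \<open>e\<close>. On the first part, \<open>M \<otimes> I\<close> acts as the scalar matrix \<open>M\<close>; it
  keeps the two parts orthogonal; and the second part has fewer nonzero entries than \<open>v\<close>, since
  its \<open>k\<close>-th entry is now zero. Induction on the number of nonzero entries then adds up the
  estimates by Pythagoras.
\<close>

lemma norm_ampl_le:
  fixes M :: "complex ^ 'r::finite ^ 's::finite" and v :: "'h::complex_inner ^ 'r"
  shows "norm (ampl M v) \<le> onorm (\<lambda>x. M *v x) * norm v"
proof -
  define c where "c = onorm (\<lambda>x. M *v x)"
  have c: "0 \<le> c" "\<And>x. norm (M *v x) \<le> c * norm x"
    using onorm_pos_le[OF bounded_linear_matrix] onorm[OF bounded_linear_matrix]
    by (auto simp: c_def)
  have "(norm (ampl M v))\<^sup>2 \<le> c\<^sup>2 * (norm v)\<^sup>2"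
  proof (induction "card {k. v $ k \<noteq> 0}" arbitrary: v rule: less_induct)
    case less
    show ?case
    proof (cases "\<exists>k. v $ k \<noteq> 0")
      case False
      then show ?thesis by (simp add: ampl_def zero_vec_def[symmetric])
    next
      case True
      then obtain k where k: "v $ k \<noteq> 0" by blast
      define e where "e = (1 / norm (v $ k)) *\<^sub>R (v $ k)"
      have e1: "norm e = 1" using k by (simp add: e_def)
      then have ee: "cinner e e = 1" by (simp add: cinner_self)
      define x where "x = (\<chi> i. cinner (v $ i) e)"
      define p where "p = (\<chi> i. (x $ i) *\<^sub>C e)"
      define u where "u = v - p"
      have v: "v = p + u" by (simp add: u_def)
      have orth: "cinner e (u $ i) = 0" for i
        by (simp add: u_def p_def x_def cinner_diff_right cinner_scaleC_right ee
            cinner_commute[of "v $ i" e])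
      have vk: "v $ k = complex_of_real (norm (v $ k)) *\<^sub>C e"
        using k by (simp add: e_def scaleC_of_real)
      have "x $ k = complex_of_real (norm (v $ k))"
        unfolding x_def vec_lambda_beta by (subst vk) (simp add: cinner_scaleC_left ee)
      then have uk: "u $ k = 0"
        using vk by (simp add: u_def p_def)
      have "u $ i = 0" if "v $ i = 0" for i
        using that by (simp add: u_def p_def x_def)
      then have "{i. u $ i \<noteq> 0} \<subset> {i. v $ i \<noteq> 0}"
        using uk k by blast
      then have "card {i. u $ i \<noteq> 0} < card {i. v $ i \<noteq> 0}"
        by (intro psubset_card_mono) auto
      then have IH: "(norm (ampl M u))\<^sup>2 \<le> c\<^sup>2 * (norm u)\<^sup>2"
        by (rule less.hyps)
      have Mp: "ampl M p = (\<chi> i. ((M *v x) $ i) *\<^sub>C e)"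
        unfolding p_def by (rule ampl_tensor)
      have "(norm (ampl M v))\<^sup>2 = (norm (ampl M p))\<^sup>2 + (norm (ampl M u))\<^sup>2"
        unfolding v ampl_add Mp
        by (intro norm_add_square_orthogonal cinner_ampl_eq_0 orth)
      also have "norm (ampl M p) = norm (M *v x)"
        unfolding Mp by (rule norm_tensor_unit[OF e1])
      also have "(norm (M *v x))\<^sup>2 \<le> (c * norm x)\<^sup>2"
        by (intro power_mono c) simp
      also have "(c * norm x)\<^sup>2 + (norm (ampl M u))\<^sup>2 \<le> c\<^sup>2 * ((norm x)\<^sup>2 + (norm u)\<^sup>2)"
        using IH by (simp add: power_mult_distrib ring_distribs)
      also have "(norm x)\<^sup>2 + (norm u)\<^sup>2 = (norm v)\<^sup>2"
        using norm_add_square_orthogonal[OF cinner_tensor_eq_0[OF orth], of x]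
          norm_tensor_unit[OF e1, of x]
        unfolding p_def[symmetric] v[symmetric] by simp
      finally show ?thesis by simp
    qed
  qed
  then have "(norm (ampl M v))\<^sup>2 \<le> (c * norm v)\<^sup>2"
    by (simp add: power_mult_distrib)
  then show ?thesis
    unfolding c_def[symmetric] by (rule power2_le_imp_le) (simp add: c(1))
qed

section \<open>Corners of unitary operators\<close>

lemma surj_diff_of_strict_contraction:
  fixes K :: "'a::banach \<Rightarrow> 'a"
  assumes "0 \<le> c" "c < 1" and "\<And>x y. norm (K x - K y) \<le> c * norm (x - y)"
  shows "surj (\<lambda>y. y - K y)"
  unfolding surj_def
proof
  fix b
  have "\<exists>!y. K y + b = y"
    by (rule banach_fix_type[OF assms(1,2)]) (simp add: dist_norm assms(3))
  then obtain y where "K y + b = y" by blast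
  then have "b = y - K y" by (simp add: eq_diff_eq add.commute)
  then show "\<exists>y. b = y - K y" ..
qed

text \<open>
  The inverse of a unitary operator is its adjoint, and the adjoint of a corner is the opposite
  corner of the adjoint. Surjectivity of the block operator is used to produce an adjoint
  of \<open>D\<close> at all, which is what makes the choice in \<open>cadjoint\<close> meaningful.
\<close>

lemma cadjoint_corner_eq:
  fixes A :: "'a::complex_inner \<Rightarrow> 'c::complex_inner" and B :: "'b::complex_inner \<Rightarrow> 'c"
    and C :: "'a \<Rightarrow> 'e::complex_inner" and D :: "'b \<Rightarrow> 'e"
  assumes V: "unitary_op (block_op A B C D)" and "A 0 = 0" "C 0 = 0"
    and "block_op A B C D (a, y) = (0, w)"
  shows "cadjoint D w = y"
proof -
  let ?V = "block_op A B C D"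
  have surj: "surj ?V" and iso: "\<And>p q. cinner (?V p) (?V q) = cinner p q"
    using V by (auto simp: unitary_op_def)
  have corner: "cinner (D x) w' = cinner x (snd p)" if "?V p = (0, w')" for x w' p
  proof -
    have "?V (0, x) = (B x, D x)" using assms by (simp add: block_op_def)
    then have "cinner (D x) w' = cinner (?V (0, x)) (?V p)"
      unfolding that by (simp add: cinner_prod_def)
    also have "\<dots> = cinner x (snd p)" unfolding iso by (simp add: cinner_prod_def)
    finally show ?thesis .
  qed
  have "\<forall>x w'. cinner (D x) w' = cinner x (snd (inv ?V (0, w')))"
    using corner surj_f_inv_f[OF surj] by blast
  then have "\<exists>G. \<forall>x y. cinner (D x) y = cinner x (G y)"
    by (intro exI)
  then have "\<forall>x y. cinner (D x) y = cinner x (cadjoint D y)"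
    unfolding cadjoint_def by (rule someI_ex)
  then have "cinner x (cadjoint D w) = cinner x y" for x
    using corner[OF assms(4), of x] by simp
  then show ?thesis by (rule cinner_ext)
qed

lemma norm_unitary: "unitary_op V \<Longrightarrow> norm (V x) = norm x"
  by (rule norm_eq_if_cinner_preserved) (simp add: unitary_op_def)

text \<open>
  Subtracting from \<open>(a, y)\<close> the preimage of \<open>(z, 0)\<close> leaves a preimage of \<open>(0, w)\<close>, whose second
  component is \<open>D\<^sup>* w\<close>; the vector subtracted has norm \<open>\<parallel>z\<parallel>\<close>.
\<close>

lemma cadjoint_corner_estimate:
  fixes A :: "'a::complex_inner \<Rightarrow> 'c::complex_inner" and B :: "'b::complex_inner \<Rightarrow> 'c"
    and C :: "'a \<Rightarrow> 'e::complex_inner" and D :: "'b \<Rightarrow> 'e"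
  assumes V: "unitary_op (block_op A B C D)" and "A 0 = 0" "C 0 = 0"
    and eq: "block_op A B C D (a, y) = (z, w)"
  shows "norm (cadjoint D w - y) \<le> norm z"
proof -
  let ?V = "block_op A B C D"
  have "surj ?V" using V by (simp add: unitary_op_def)
  then obtain u where u: "?V u = (z, 0)" by (metis surjD)
  have "bounded_linear ?V" using V by (simp add: unitary_op_def bounded_clinear_def)
  then have "?V ((a, y) - u) = (0, w)"
    by (simp only: bounded_linear.linear linear_diff eq u) simp
  moreover have "(a, y) - u = (a - fst u, y - snd u)" by (simp add: prod_eq_iff)
  ultimately have "?V (a - fst u, y - snd u) = (0, w)" by simp
  then have "cadjoint D w = y - snd u"
    by (rule cadjoint_corner_eq[OF V assms(2,3)])
  then have "norm (cadjoint D w - y) = norm (snd u)" by simp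
  also have "\<dots> \<le> norm u" using norm_snd_le[of "snd u" "fst u"] by simp
  also have "\<dots> = norm z" using norm_unitary[OF V, of u] u by (simp add: norm_prod_def)
  finally show ?thesis .
qed

lemma corner_contraction:
  fixes A :: "'a::complex_inner \<Rightarrow> 'c::complex_inner" and B :: "'b::complex_inner \<Rightarrow> 'c"
    and C :: "'a \<Rightarrow> 'e::complex_inner" and D :: "'b \<Rightarrow> 'e"
  assumes V: "unitary_op (block_op A B C D)" and "C 0 = 0"
  shows "norm (D y) \<le> norm y"
proof -
  have "norm (D y) = norm (snd (block_op A B C D (0, y)))"
    using assms by (simp add: block_op_def)
  also have "\<dots> \<le> norm (block_op A B C D (0, y))"
    using norm_snd_le[of "snd (block_op A B C D (0, y))" "fst (block_op A B C D (0, y))"] by simp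
  also have "\<dots> = norm y" using norm_unitary[OF V, of "(0, y)"] by (simp add: norm_prod_def)
  finally show ?thesis .
qed

section \<open>Realizations and approximate eigenvectors\<close>

text \<open>
  This turns the resolvent in the transfer function into a feedback equation: the input \<open>(1, y)\<close>
  to the block operator, with \<open>y\<close> the feedback \<open>(Q(z) \<otimes> I) w\<close> of the output, produces \<open>f z\<close>.
\<close>

lemma transfer_function_feedback:
  fixes Q :: "'d::finite \<Rightarrow> complex ^ 'r::finite ^ 's::finite"
    and B :: "'h::chilbert_space ^ 's \<Rightarrow> complex"
  assumes real: "unitary_realization Q f A B C D" and z: "z \<in> matrix_ball Q"
  obtains w where "block_op A B C D (1, ampl (pencil Q z) w) = (f z, w)"
proof -
  have V: "unitary_op (block_op A B C D)" and bl: "bounded_linear C" "bounded_linear D"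
    and fz: "f z = transfer_function Q A B C D z"
    using real z by (auto simp: unitary_realization_def bounded_clinear_def)
  define L :: "'h ^ 'r \<Rightarrow> 'h ^ 's" where "L = ampl (pencil Q z)"
  define c where "c = onorm (\<lambda>v. pencil Q z *v v)"
  have c: "0 \<le> c" "c < 1"
    using z onorm_pos_le[OF bounded_linear_matrix] by (auto simp: c_def matrix_ball_def)
  have contraction: "norm (L (D x) - L (D y)) \<le> c * norm (x - y)" for x y
  proof -
    have "L (D x) - L (D y) = L (D (x - y))"
      using bl by (simp add: L_def ampl_diff linear_diff bounded_linear.linear)
    also have "norm \<dots> \<le> c * norm (D (x - y))"
      unfolding L_def c_def by (rule norm_ampl_le)
    also have "\<dots> \<le> c * norm (x - y)"
      using corner_contraction[OF V] bl c by (intro mult_left_mono)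
        (auto simp: linear_0 bounded_linear.linear)
    finally show ?thesis .
  qed
  have surj: "surj (\<lambda>y. y - L (D y))"
    using surj_diff_of_strict_contraction[of c "\<lambda>y. L (D y)"] c contraction by blast
  define y where "y = inv (\<lambda>y. y - L (D y)) (L (C 1))"
  have "y - L (D y) = L (C 1)"
    unfolding y_def by (rule surj_f_inv_f[OF surj])
  then have y: "y = L (C 1 + D y)"
    by (simp add: L_def ampl_add diff_eq_eq)
  have "f z = A 1 + B y"
    unfolding fz transfer_function_def y_def L_def ..
  then have "block_op A B C D (1, L (C 1 + D y)) = (f z, C 1 + D y)"
    using y by (simp add: block_op_def)
  then show ?thesis using that unfolding L_def by blast
qed

lemma approx_spectrumI:
  assumes "\<And>e. 0 < e \<Longrightarrow> \<exists>v. norm v = 1 \<and> norm (T v - ampl (pencil Q l) v) < e"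
  shows "l \<in> approx_spectrum Q T"
proof -
  have "\<exists>v. norm v = 1 \<and> norm (T v - ampl (pencil Q l) v) < inverse (real (Suc k))" for k
    by (rule assms) simp
  then obtain v where v: "\<And>k. norm (v k) = 1"
    "\<And>k. norm (T (v k) - ampl (pencil Q l) (v k)) < inverse (real (Suc k))"
    by metis
  have "(\<lambda>k. norm (T (v k) - ampl (pencil Q l) (v k))) \<longlonglongrightarrow> 0"
    by (rule tendsto_sandwich[OF _ _ tendsto_const LIMSEQ_inverse_real_of_nat])
      (use v(2) in \<open>auto intro!: always_eventually less_imp_le simp del: of_nat_Suc\<close>)
  then show ?thesis using v(1) by (auto simp: approx_spectrum_def)
qed

lemma cadjoint_corner_scaleR:
  fixes A :: "'a::complex_inner \<Rightarrow> 'c::complex_inner" and B :: "'b::complex_inner \<Rightarrow> 'c"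
    and C :: "'a \<Rightarrow> 'e::complex_inner" and D :: "'b \<Rightarrow> 'e"
  assumes V: "unitary_op (block_op A B C D)" and "A 0 = 0" "C 0 = 0"
  shows "cadjoint D (t *\<^sub>R w) = t *\<^sub>R cadjoint D w"
proof -
  let ?V = "block_op A B C D"
  have "surj ?V" and bl: "bounded_linear ?V"
    using V by (simp_all add: unitary_op_def bounded_clinear_def)
  then obtain a y where ay: "?V (a, y) = (0, w)" by (metis surjD surj_pair)
  have "?V (t *\<^sub>R (a, y)) = t *\<^sub>R (0, w)"
    using linear_scale[OF bounded_linear.linear[OF bl]] ay by metis
  then have "?V (t *\<^sub>R a, t *\<^sub>R y) = (0, t *\<^sub>R w)" by simp
  from cadjoint_corner_eq[OF assms this] cadjoint_corner_eq[OF assms ay] show ?thesis by simp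
qed

theorem theorem5p8:
  fixes Q :: "'d::finite \<Rightarrow> complex ^ 'r::finite ^ 's::finite"
    and f :: "complex ^ 'd \<Rightarrow> complex"
    and A :: "complex \<Rightarrow> complex"
    and B :: "'h::chilbert_space ^ 's \<Rightarrow> complex"
    and C :: "complex \<Rightarrow> 'h ^ 'r"
    and D :: "'h ^ 's \<Rightarrow> 'h ^ 'r"
  assumes "f \<in> schur_agler Q"
    and "\<not> f constant_on matrix_ball Q"
    and "unitary_realization Q f A B C D"
  shows "boundary_zeros Q f \<subseteq> approx_spectrum Q (cadjoint D)"
proof
  fix l assume "l \<in> boundary_zeros Q f"
  then have bdry: "onorm (\<lambda>v. pencil Q l *v v) = 1"
    and lim: "((\<lambda>t. f (t *\<^sub>R l)) \<longlongrightarrow> 0) (at_left 1)"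
    by (auto simp: boundary_zeros_def matrix_ball_bdry_def)
  have V: "unitary_op (block_op A B C D)" and "bounded_linear A" "bounded_linear C"
    using assms(3) by (auto simp: unitary_realization_def bounded_clinear_def)
  then have zero: "A 0 = 0" "C 0 = 0"
    by (simp_all add: linear_0 bounded_linear.linear)
  show "l \<in> approx_spectrum Q (cadjoint D)"
  proof (rule approx_spectrumI)
    fix e :: real assume "0 < e"
    \<comment> \<open>With \<open>\<bar>f (t \<lambda>)\<bar>\<close> and \<open>1 - t\<close> below \<open>d\<close>, the error before normalizing is at most \<open>d + d \<parallel>w\<parallel>\<close>; the
      bound \<open>d \<le> 1 / 2\<close> forces \<open>\<parallel>w\<parallel> \<ge> 1 / 2\<close>, so this is at most \<open>3 d \<parallel>w\<parallel>\<close>.\<close>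
    define d where "d = min (1 / 2) (e / 4)"
    have d: "0 < d" "d \<le> 1 / 2" "3 * d < e"
      using \<open>0 < e\<close> by (auto simp: d_def)
    have "eventually (\<lambda>t. dist (f (t *\<^sub>R l)) 0 < d) (at_left 1)"
      using lim d(1) by (rule tendstoD)
    moreover have "eventually (\<lambda>t. t \<in> {1 - d<..<1}) (at_left 1)"
      using d(1) by (intro eventually_at_leftI[of "1 - d"]) auto
    ultimately have "eventually (\<lambda>t. cmod (f (t *\<^sub>R l)) < d \<and> 1 - d < t \<and> t < 1) (at_left 1)"
      by eventually_elim simp
    then obtain t where t: "cmod (f (t *\<^sub>R l)) < d" "1 - d < t" "t < 1"
      using eventually_happens'[OF trivial_limit_at_left_real] by blast
    have "0 < t" using t d by simp
    have "onorm (\<lambda>v. pencil Q (t *\<^sub>R l) *v v) = t"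
    proof -
      have "(\<lambda>v. pencil Q (t *\<^sub>R l) *v v) = (\<lambda>v. t *\<^sub>R (pencil Q l *v v))"
        by (simp add: pencil_scaleR matrix_vector_mult_def vec_eq_iff fun_eq_iff scaleR_sum_right)
      then show ?thesis
        using onorm_scaleR[OF bounded_linear_matrix, of t "pencil Q l"] \<open>0 < t\<close> bdry by simp
    qed
    then have "t *\<^sub>R l \<in> matrix_ball Q" using t by (simp add: matrix_ball_def)
    then obtain w where w: "block_op A B C D (1, ampl (pencil Q (t *\<^sub>R l)) w) = (f (t *\<^sub>R l), w)"
      by (rule transfer_function_feedback[OF assms(3)])
    define Lw where "Lw = ampl (pencil Q l) w"
    have w': "block_op A B C D (1, t *\<^sub>R Lw) = (f (t *\<^sub>R l), w)"
      using w by (simp add: Lw_def pencil_scaleR ampl_scaleR)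
    have "1 \<le> (cmod (f (t *\<^sub>R l)))\<^sup>2 + (norm w)\<^sup>2"
    proof -
      have "norm (f (t *\<^sub>R l), w) = norm (1 :: complex, t *\<^sub>R Lw)"
        using norm_unitary[OF V, of "(1, t *\<^sub>R Lw)"] w' by simp
      then have "1 + (norm (t *\<^sub>R Lw))\<^sup>2 = (cmod (f (t *\<^sub>R l)))\<^sup>2 + (norm w)\<^sup>2"
        by (simp add: norm_prod_def)
      moreover have "0 \<le> (norm (t *\<^sub>R Lw))\<^sup>2" by simp
      ultimately show ?thesis by linarith
    qed
    moreover have "(cmod (f (t *\<^sub>R l)))\<^sup>2 \<le> (1 / 2)\<^sup>2"
      using t d by (intro power_mono) auto
    ultimately have "(1 / 2)\<^sup>2 \<le> (norm w)\<^sup>2"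
      by (simp add: power2_eq_square)
    then have w_ge: "1 / 2 \<le> norm w"
      by (rule power2_le_imp_le) simp
    have corner: "norm (cadjoint D w - t *\<^sub>R Lw) \<le> d"
      using cadjoint_corner_estimate[OF V zero w'] t by simp
    have radial: "norm ((1 - t) *\<^sub>R Lw) \<le> d * norm w"
      using norm_ampl_le[of "pencil Q l" w] t d unfolding Lw_def[symmetric] bdry
      by (simp add: mult_mono)
    have "cadjoint D w - Lw = (cadjoint D w - t *\<^sub>R Lw) - (1 - t) *\<^sub>R Lw"
      by (simp add: scaleR_diff_left)
    also have "norm \<dots> \<le> norm (cadjoint D w - t *\<^sub>R Lw) + norm ((1 - t) *\<^sub>R Lw)"
      by (rule norm_triangle_ineq4)
    also have "\<dots> \<le> d + d * norm w"
      using corner radial by (rule add_mono)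
    also have "\<dots> \<le> 3 * d * norm w"
      using mult_left_mono[OF w_ge, of "2 * d"] d(1) by simp
    finally have bound: "norm (cadjoint D w - Lw) \<le> 3 * d * norm w" .
    define v where "v = (1 / norm w) *\<^sub>R w"
    have "cadjoint D v - ampl (pencil Q l) v = (1 / norm w) *\<^sub>R (cadjoint D w - Lw)"
      by (simp add: v_def Lw_def cadjoint_corner_scaleR[OF V zero] ampl_scaleR_right
          scaleR_diff_right)
    then have "norm (cadjoint D v - ampl (pencil Q l) v) \<le> 3 * d"
      using bound w_ge d(1) by (simp add: divide_simps)
    moreover have "norm v = 1" using w_ge by (auto simp: v_def)
    ultimately show "\<exists>v. norm v = 1 \<and> norm (cadjoint D v - ampl (pencil Q l) v) < e"
      using d(3) by (intro exI[of _ v]) auto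
  qed
qed

end
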